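(* Consider the system $x^+=f(x,w)$, $y=h(x)+v$ and the FIE described in the context. The FIE is RGAS if the following hold: (a) the system is i-IOSS with functions $\beta\in\mathcal{KL}$, $\alpha_1,\alpha_2\in\mathcal{K}$; (b) the infimum in the FIE problem is attained for every $t$, and the cost $V_t(\chi(0)-\bar x_0,\boldsymbol\omega)$ is continuous and satisfies, for all $\chi(0),\bar x_0\in\mathbb{R}^n$, $\boldsymbol\omega\in\mathbb{B}_w$, $\boldsymbol\nu\in\mathbb{B}_v$ and all $t$, $$\underline{\rho}_x(|\chi(0)-\bar x_0|,t)+\underline{\gamma}_w(\|\boldsymbol\omega\|_{0:t-1})+\underline{\gamma}_v(\|\boldsymbol\nu\|_{0:t})\le V_t(\chi(0)-\bar x_0,\boldsymbol\omega)\le \rho_x(|\chi(0)-\bar x_0|,t)+\gamma_w(\|\boldsymbol\omega\|_{0:t-1})+\gamma_v(\|\boldsymbol\nu\|_{0:t})$$ for some $\underline{\rho}_x,\rho_x\in\mathcal{KL}$ and $\underline{\gamma}_w,\underline{\gamma}_v,\gamma_w,\gamma_v\in\mathcal{K}_\infty$; (c) $\beta(s,t)=\mu_1(s)\varphi_1(t)$, $\underline{\rho}_x(s,t)=\mu_2(s)\varphi_2(t)$ and $\rho_x(s,t)=\mu_3(s)\varphi_2(t)$ with $\mu_1,\mu_2,\mu_3\in\mathcal{K}$ and $\varphi_1,\varphi_2\in\mathcal{L}$, and for an arbitrary $\pi\in\mathcal{K}$ there is some $\pi'\in\mathcal{K}$ such that $$\mu_1\!\left(4\mu_2^{-1}\!\left(\frac{\pi(s)}{\varphi_2(t)}\right)\right)\varphi_1(t)\le\pi'(s)\quad\text{for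 all } s,t\ge0.$$
   Context: Notation: $|\cdot|$ is the Euclidean norm; for a sequence $\boldsymbol x=\{x(0),x(1),\dots\}$, $\|\boldsymbol x\|_{a:b}=\max_{a\le i\le b}|x(i)|$. $\mathcal{K}$: continuous, zero at zero, strictly increasing functions $\mathbb{R}_{\ge0}\to\mathbb{R}_{\ge0}$; $\mathcal{K}_\infty$: $\mathcal{K}$-functions tending to $\infty$; $\mathcal{L}$: continuous nonincreasing functions $\mathbb{R}_{\ge0}\to\mathbb{R}_{\ge0}$ tending to $0$; $\mathcal{KL}$: functions $\beta(s,t)$ that are $\mathcal{K}$ in $s$ for each fixed $t$ and $\mathcal{L}$ in $t$ for each fixed $s$. System: $x(t+1)=f(x(t),w(t))$, $y(t)=h(x(t))+v(t)$, with $x\in\mathbb{R}^n$, $w\in\mathbb{R}^g$, $y,v\in\mathbb{R}^p$, $f,h$ continuous and known; the initial state and disturbance sequences $\boldsymbol w,\boldsymbol v$ are unknown but bounded. $x(t;x_0,\boldsymbol w)$ denotes the state at time $t$ from $x(0)=x_0$ under disturbance $\boldsymbol w$. i-IOSS: the system $x^+=f(x,w)$, $y=h(x)$ is i-IOSS if there exist $\beta\in\mathcal{KL}$, $\alpha_1,\alpha_2\in\mathcal{K}$ such that for all initial states $x_{01},x_{02}$, disturbances $\boldsymbol w_1,\boldsymbol w_2$ and all $t\in\mathbb{I}_{\ge0}$: $|x(t;x_{01},\boldsymbol w_1)-x(t;x_{02},\boldsymbol w_2)|\le\beta(|x_{01}-x_{02}|,t)+\alpha_1(\|\boldsymbol w_1-\boldsymbol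 w_2\|_{0:t-1})+\alpha_2(\|\boldsymbol y_1-\boldsymbol y_2\|_{0:t})$, where $y_j(i)=h(x(i;x_{0j},\boldsymbol w_j))$. FIE: the measurements are $y(i)=h(x(i;x_0,\boldsymbol w))+v(i)$ and $\bar x_0$ is a prior estimate of the initial state. At time $t$ the FIE solves $\inf_{\chi(0),\boldsymbol\omega}V_t(\chi(0)-\bar x_0,\boldsymbol\omega)$ subject to $\chi(i+1)=f(\chi(i),\omega(i))$, $y(i)=h(\chi(i))+\nu(i)$ for $i\in\mathbb{I}_{0:t}$, $\boldsymbol\omega\in\mathbb{B}_w$, $\boldsymbol\nu\in\mathbb{B}_v$, where $\mathbb{B}_w,\mathbb{B}_v$ are given sets of bounded disturbance sequences; $\boldsymbol\nu$ is determined by $\chi(0),\boldsymbol\omega$ and the data. The optimal solution is denoted $(\hat x(0|t),\hat{\boldsymbol w}_t)$. RGAS: the estimate is RGAS if for all $x_0,\bar x_0$ and bounded $(\boldsymbol w,\boldsymbol v)$ there exist $\beta_x\in\mathcal{KL}$ and $\alpha_w,\alpha_v\in\mathcal{K}$ such that for all $t\in\mathbb{I}_{\ge0}$: $|x(t;x_0,\boldsymbol w)-x(t;\hat x(0|t),\hat{\boldsymbol w}_t)|\le\beta_x(|x_0-\bar x_0|,t)+\alpha_w(\|\boldsymbol w\|_{0:t-1})+\alpha_v(\|\boldsymbol v\|_{0:t})$. *)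

theory Defs
  imports "HOL-Analysis.Analysis"
begin

definition classK :: "(real \<Rightarrow> real) \<Rightarrow> bool" where
  "classK \<alpha> \<longleftrightarrow> continuous_on {0..} \<alpha> \<and> \<alpha> 0 = 0 \<and> strict_mono_on {0..} \<alpha>"

definition classKinf :: "(real \<Rightarrow> real) \<Rightarrow> bool" where
  "classKinf \<alpha> \<longleftrightarrow> classK \<alpha> \<and> filterlim \<alpha> at_top at_top"

definition classL :: "(real \<Rightarrow> real) \<Rightarrow> bool" where
  "classL \<phi> \<longleftrightarrow> continuous_on {0..} \<phi> \<and> (\<forall>t\<ge>0. \<phi> t \<ge> 0)
     \<and> (\<forall>s t. 0 \<le> s \<longrightarrow> s \<le> t \<longrightarrow> \<phi> t \<le> \<phi> s) \<and> (\<phi> \<longlongrightarrow> 0) at_top"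

definition classKL :: "(real \<Rightarrow> real \<Rightarrow> real) \<Rightarrow> bool" where
  "classKL \<beta> \<longleftrightarrow> (\<forall>t\<ge>0. classK (\<lambda>s. \<beta> s t)) \<and> (\<forall>s\<ge>0. classL (\<beta> s))"

primrec traj :: "('x \<Rightarrow> 'w \<Rightarrow> 'x) \<Rightarrow> 'x \<Rightarrow> (nat \<Rightarrow> 'w) \<Rightarrow> nat \<Rightarrow> 'x" where
  "traj f x0 w 0 = x0"
| "traj f x0 w (Suc t) = f (traj f x0 w t) (w t)"

text \<open>seg_norm w k = max over 0 <= i <= k-1 of norm (w i), i.e. the norm on 0:k-1
  (which is 0 for k = 0, the empty range).  Thus the paper's norm on 0:t-1 is seg_norm w t
  and the norm on 0:t is seg_norm w (Suc t).\<close>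

definition seg_norm :: "(nat \<Rightarrow> 'a::real_normed_vector) \<Rightarrow> nat \<Rightarrow> real" where
  "seg_norm w k = Max (insert 0 ((\<lambda>i. norm (w i)) ` {..<k}))"

definition iIOSS ::
  "('x::real_normed_vector \<Rightarrow> 'w::real_normed_vector \<Rightarrow> 'x) \<Rightarrow> ('x \<Rightarrow> 'y::real_normed_vector)
   \<Rightarrow> (real \<Rightarrow> real \<Rightarrow> real) \<Rightarrow> (real \<Rightarrow> real) \<Rightarrow> (real \<Rightarrow> real) \<Rightarrow> bool" where
  "iIOSS f h \<beta> \<alpha>1 \<alpha>2 \<longleftrightarrow> classKL \<beta> \<and> classK \<alpha>1 \<and> classK \<alpha>2 \<and>
     (\<forall>x01 x02 w1 w2 t.
        norm (traj f x01 w1 t - traj f x02 w2 t)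
          \<le> \<beta> (norm (x01 - x02)) (real t)
            + \<alpha>1 (seg_norm (\<lambda>i. w1 i - w2 i) t)
            + \<alpha>2 (seg_norm (\<lambda>i. h (traj f x01 w1 i) - h (traj f x02 w2 i)) (Suc t)))"

text \<open>Measurement residual nu(i) = y(i) - h(chi(i)) for i in 0:t, determined by chi(0), omega
  and the data; represented as a sequence that is zero after time t.\<close>

definition resid ::
  "('x \<Rightarrow> 'w \<Rightarrow> 'x) \<Rightarrow> ('x \<Rightarrow> 'y::ab_group_add) \<Rightarrow> (nat \<Rightarrow> 'y) \<Rightarrow> nat \<Rightarrow> 'x \<Rightarrow> (nat \<Rightarrow> 'w)
   \<Rightarrow> nat \<Rightarrow> 'y" where
  "resid f h y t \<chi>0 \<omega> = (\<lambda>i. if i \<le> t then y i - h (traj f \<chi>0 \<omega> i) else 0)"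

definition FIE_feasible ::
  "('x \<Rightarrow> 'w \<Rightarrow> 'x) \<Rightarrow> ('x \<Rightarrow> 'y::ab_group_add) \<Rightarrow> (nat \<Rightarrow> 'w) set \<Rightarrow> (nat \<Rightarrow> 'y) set
   \<Rightarrow> (nat \<Rightarrow> 'y) \<Rightarrow> nat \<Rightarrow> 'x \<Rightarrow> (nat \<Rightarrow> 'w) \<Rightarrow> bool" where
  "FIE_feasible f h Bw Bv y t \<chi>0 \<omega> \<longleftrightarrow> \<omega> \<in> Bw \<and> resid f h y t \<chi>0 \<omega> \<in> Bv"

definition FIE_optimal ::
  "('x::ab_group_add \<Rightarrow> 'w \<Rightarrow> 'x) \<Rightarrow> ('x \<Rightarrow> 'y::ab_group_add) \<Rightarrow> (nat \<Rightarrow> 'w) set \<Rightarrow> (nat \<Rightarrow> 'y) set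
   \<Rightarrow> (nat \<Rightarrow> 'x \<Rightarrow> (nat \<Rightarrow> 'w) \<Rightarrow> (nat \<Rightarrow> 'y) \<Rightarrow> real) \<Rightarrow> (nat \<Rightarrow> 'y) \<Rightarrow> 'x
   \<Rightarrow> nat \<Rightarrow> 'x \<Rightarrow> (nat \<Rightarrow> 'w) \<Rightarrow> bool" where
  "FIE_optimal f h Bw Bv V y xbar t \<chi>0 \<omega> \<longleftrightarrow>
     FIE_feasible f h Bw Bv y t \<chi>0 \<omega> \<and>
     (\<forall>\<chi>0' \<omega>'. FIE_feasible f h Bw Bv y t \<chi>0' \<omega>' \<longrightarrow>
        V t (\<chi>0 - xbar) \<omega> (resid f h y t \<chi>0 \<omega>) \<le> V t (\<chi>0' - xbar) \<omega>' (resid f h y t \<chi>0' \<omega>'))"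

end

theory Submission
  imports Defs
begin

text \<open>The optimal FIE cost is at most the cost of the true initial state and disturbances, so
  every term of the lower cost bound at the estimate (the prior mismatch and the sizes of the
  estimated disturbances and residuals) is dominated by the upper cost bound \<open>U\<close> evaluated at the
  truth. The i-IOSS estimate between the true and the estimated trajectory splits, by the
  triangle inequality, into terms in the true data and terms in the estimate; the latter become
  class-\<open>\<K>\<close> functions of \<open>U\<close>, via condition (c) with \<open>\<pi>\<close> the identity for the initial state and via
  inverses of the \<open>\<K>\<^sub>\<infinity>\<close> lower gains for the disturbances. Expanding \<open>U\<close> gives the gains.\<close>

lemma classK_nonneg: "classK \<alpha> \<Longrightarrow> 0 \<le> s \<Longrightarrow> 0 \<le> \<alpha> s"
  unfolding classK_def strict_mono_on_def
  by (metis atLeast_iff less_eq_real_def order_refl)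

lemma classK_mono: "classK \<alpha> \<Longrightarrow> 0 \<le> a \<Longrightarrow> a \<le> b \<Longrightarrow> \<alpha> a \<le> \<alpha> b"
  unfolding classK_def strict_mono_on_def
  by (metis atLeast_iff order.trans less_eq_real_def)

lemma classKinf_imp_classK: "classKinf \<gamma> \<Longrightarrow> classK \<gamma>"
  by (simp add: classKinf_def)

lemma classK_ident: "classK (\<lambda>s. s)"
  unfolding classK_def strict_mono_on_def by (auto simp: continuous_on_id)

lemma classK_add: "classK \<alpha> \<Longrightarrow> classK \<gamma> \<Longrightarrow> classK (\<lambda>s. \<alpha> s + \<gamma> s)"
  unfolding classK_def strict_mono_on_def
  by (auto intro!: continuous_intros add_strict_mono)

lemma classK_comp:
  assumes \<alpha>: "classK \<alpha>" and \<gamma>: "classK \<gamma>"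
  shows "classK (\<lambda>s. \<alpha> (\<gamma> s))"
proof -
  have img: "\<gamma> ` {0..} \<subseteq> {0..}"
    using classK_nonneg[OF \<gamma>] by auto
  show ?thesis
    unfolding classK_def
  proof (intro conjI)
    show "continuous_on {0..} (\<lambda>s. \<alpha> (\<gamma> s))"
      by (rule continuous_on_compose2[OF _ _ img]) (use \<alpha> \<gamma> in \<open>auto simp: classK_def\<close>)
    show "strict_mono_on {0..} (\<lambda>s. \<alpha> (\<gamma> s))"
      using \<alpha> \<gamma> img unfolding classK_def strict_mono_on_def by (auto simp: image_subset_iff)
  qed (use \<alpha> \<gamma> in \<open>simp add: classK_def\<close>)
qed

lemma classK_scale: "classK \<alpha> \<Longrightarrow> 0 < c \<Longrightarrow> classK (\<lambda>s. \<alpha> (c * s))"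
  by (rule classK_comp) (auto simp: classK_def strict_mono_on_def intro!: continuous_intros)

lemma classK_add_le:
  assumes "classK \<alpha>" "0 \<le> a" "0 \<le> b"
  shows "\<alpha> (a + b) \<le> \<alpha> (2 * a) + \<alpha> (2 * b)"
proof -
  have "\<alpha> (a + b) \<le> \<alpha> (2 * max a b)"
    by (rule classK_mono) (use assms in auto)
  then show ?thesis
    using classK_nonneg[OF assms(1), of "2 * a"] classK_nonneg[OF assms(1), of "2 * b"] assms
    by (auto simp: max_def split: if_splits)
qed

lemma classK_add3_le:
  assumes "classK \<alpha>" "0 \<le> a" "0 \<le> b" "0 \<le> c"
  shows "\<alpha> (a + b + c) \<le> \<alpha> (3 * a) + \<alpha> (3 * b) + \<alpha> (3 * c)"
proof -
  have "\<alpha> (a + b + c) \<le> \<alpha> (3 * max a (max b c))"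
    by (rule classK_mono) (use assms in auto)
  then show ?thesis
    using classK_nonneg[OF assms(1), of "3 * a"] classK_nonneg[OF assms(1), of "3 * b"]
      classK_nonneg[OF assms(1), of "3 * c"] assms
    by (auto simp: max_def split: if_splits)
qed

text \<open>Extended by the identity on the negative reals, a class-\<open>\<K>\<^sub>\<infinity>\<close> function becomes a
  homeomorphism of \<open>\<real>\<close>; its global inverse then inverts the original function on \<open>[0,\<infinity>)\<close>.\<close>

definition id_extension :: "(real \<Rightarrow> real) \<Rightarrow> real \<Rightarrow> real" where
  "id_extension \<gamma> z = (if 0 \<le> z then \<gamma> z else z)"

lemma strict_mono_id_extension:
  assumes "classK \<gamma>"
  shows "strict_mono (id_extension \<gamma>)"
proof (rule strict_monoI)
  fix x y :: real
  assume xy: "x < y"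
  have \<gamma>_less: "\<gamma> r < \<gamma> s" if "0 \<le> r" "r < s" for r s
    using assms that unfolding classK_def strict_mono_on_def by auto
  show "id_extension \<gamma> x < id_extension \<gamma> y"
  proof (cases "0 \<le> x")
    case True
    then show ?thesis using \<gamma>_less[of x y] xy by (simp add: id_extension_def)
  next
    case False
    then have "x < id_extension \<gamma> y"
      using \<gamma>_less[of 0 y] classK_nonneg[OF assms, of y] xy assms
      by (cases "y = 0") (auto simp: id_extension_def classK_def)
    then show ?thesis using False by (simp add: id_extension_def)
  qed
qed

lemma continuous_id_extension:
  assumes "classK \<gamma>"
  shows "continuous_on UNIV (id_extension \<gamma>)"
proof -
  have "continuous_on {0..} (id_extension \<gamma>)"
    using assms by (auto simp: classK_def id_extension_def intro: continuous_on_eq)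
  moreover have "continuous_on {..0} (id_extension \<gamma>)"
    using assms by (auto simp: classK_def id_extension_def intro: continuous_on_eq[OF continuous_on_id])
  ultimately have "continuous_on ({..0} \<union> {0..}) (id_extension \<gamma>)"
    by (intro continuous_on_closed_Un) auto
  moreover have "{..0} \<union> {0::real..} = UNIV"
    by auto
  ultimately show ?thesis
    by simp
qed

lemma surj_id_extension:
  assumes "classKinf \<gamma>"
  shows "surj (id_extension \<gamma>)"
proof -
  have K: "classK \<gamma>" and lim: "filterlim \<gamma> at_top at_top"
    using assms by (auto simp: classKinf_def)
  have "\<exists>z. id_extension \<gamma> z = u" for u
  proof (cases "0 \<le> u")
    case True
    obtain X where X: "\<And>x. X \<le> x \<Longrightarrow> u \<le> \<gamma> x"
      using lim by (auto simp: filterlim_at_top eventually_at_top_linorder)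
    have "id_extension \<gamma> 0 \<le> u" "u \<le> id_extension \<gamma> (max X 0)"
      using K True X[of "max X 0"] by (auto simp: id_extension_def classK_def)
    moreover have "continuous_on {0..max X 0} (id_extension \<gamma>)"
      using continuous_id_extension[OF K] by (rule continuous_on_subset) auto
    ultimately show ?thesis
      using IVT'[of "id_extension \<gamma>" 0 u "max X 0"] by auto
  next
    case False
    then show ?thesis
      by (auto simp: id_extension_def)
  qed
  then show ?thesis
    by (metis surj_def)
qed

lemma classKinf_inverse:
  assumes "classKinf \<gamma>"
  obtains g where "classK g" and "\<And>a. 0 \<le> a \<Longrightarrow> g (\<gamma> a) = a"
proof -
  have K: "classK \<gamma>"
    using assms by (rule classKinf_imp_classK)
  define e where "e = id_extension \<gamma>"
  define g where "g = inv e"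
  have mono_e: "strict_mono e" and cont_e: "continuous_on UNIV e" and surj_e: "surj e"
    unfolding e_def by (fact strict_mono_id_extension[OF K] continuous_id_extension[OF K]
      surj_id_extension[OF assms])+
  have g_e: "g (e z) = z" for z
    using mono_e by (simp add: g_def strict_mono_on_imp_inj_on)
  have e_g: "e (g u) = u" for u
    using surj_e by (simp add: g_def surj_f_inv_f)
  have "strict_mono g"
    by (rule strict_monoI) (metis e_g mono_e not_less_iff_gr_or_eq strict_mono_less)
  have "isCont g (e (g u))" for u
    by (rule isCont_inverse_function[where d = 1])
      (auto simp: g_e intro: continuous_on_interior[OF cont_e])
  then have "continuous_on {0..} g"
    by (intro continuous_at_imp_continuous_on) (simp add: e_g)
  moreover have "g 0 = 0"
    using g_e[of 0] K by (simp add: e_def id_extension_def classK_def)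
  ultimately have "classK g"
    using \<open>strict_mono g\<close> by (simp add: classK_def strict_mono_on_def strict_mono_less)
  moreover have "g (\<gamma> a) = a" if "0 \<le> a" for a
    using g_e[of a] that by (simp add: e_def id_extension_def)
  ultimately show ?thesis
    using that by blast
qed

lemma classK_factor_classKinf:
  assumes "classKinf \<gamma>" and "classK \<alpha>"
  obtains \<kappa> where "classK \<kappa>" and "\<And>a. 0 \<le> a \<Longrightarrow> \<alpha> a = \<kappa> (\<gamma> a)"
proof -
  obtain g where "classK g" and "\<And>a. 0 \<le> a \<Longrightarrow> g (\<gamma> a) = a"
    using classKinf_inverse[OF assms(1)] by blast
  then show ?thesis
    using that classK_comp[OF assms(2)] by (metis (no_types, lifting))
qed

lemma classL_nonneg: "classL \<phi> \<Longrightarrow> 0 \<le> t \<Longrightarrow> 0 \<le> \<phi> t"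
  by (simp add: classL_def)

lemma classKL_div_one_plus: "classKL (\<lambda>s t. s / (1 + t))"
  unfolding classKL_def classK_def classL_def strict_mono_on_def
proof (intro conjI allI impI)
  fix s :: real
  have "filterlim (\<lambda>t::real. 1 + t) at_top at_top"
    by (rule filterlim_tendsto_add_at_top[OF tendsto_const filterlim_ident])
  then show "((\<lambda>t. s / (1 + t)) \<longlongrightarrow> 0) at_top"
    by (intro tendsto_divide_0[OF tendsto_const] filterlim_at_top_imp_at_infinity)
qed (auto intro!: continuous_intros divide_strict_right_mono divide_left_mono)

text \<open>The strictly increasing summand \<open>\<beta>\<close> is needed: \<open>\<kappa> (\<mu> s * \<phi> t)\<close> alone is not of class
  \<open>\<K>\<close> in \<open>s\<close> once \<open>\<phi> t = 0\<close>.\<close>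

lemma classKL_add_comp_mult:
  assumes \<beta>: "classKL \<beta>" and \<kappa>: "classK \<kappa>" and \<mu>: "classK \<mu>" and \<phi>: "classL \<phi>"
  shows "classKL (\<lambda>s t. \<beta> s t + \<kappa> (\<mu> s * \<phi> t))"
proof -
  have cont_\<kappa>: "continuous_on {0..} \<kappa>" and cont_\<mu>: "continuous_on {0..} \<mu>"
    using \<kappa> \<mu> by (simp_all add: classK_def)
  have prod_nonneg: "0 \<le> \<mu> s * \<phi> t" if "0 \<le> s" "0 \<le> t" for s t
    using classK_nonneg[OF \<mu>] classL_nonneg[OF \<phi>] that by simp
  show ?thesis
    unfolding classKL_def
  proof (intro conjI allI impI)
    fix t :: real
    assume t: "0 \<le> t"
    have \<beta>_t: "classK (\<lambda>s. \<beta> s t)"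
      using \<beta> t by (simp add: classKL_def)
    have "continuous_on {0..} (\<lambda>s. \<kappa> (\<mu> s * \<phi> t))"
      by (rule continuous_on_compose2[OF cont_\<kappa>]) (auto intro!: continuous_intros cont_\<mu> prod_nonneg t)
    moreover have "\<kappa> (\<mu> r * \<phi> t) \<le> \<kappa> (\<mu> s * \<phi> t)" if "0 \<le> r" "r \<le> s" for r s
      using that t prod_nonneg
      by (intro classK_mono[OF \<kappa>] mult_right_mono classK_mono[OF \<mu>] classL_nonneg[OF \<phi>]) auto
    ultimately show "classK (\<lambda>s. \<beta> s t + \<kappa> (\<mu> s * \<phi> t))"
      using \<beta>_t \<kappa> \<mu> unfolding classK_def strict_mono_on_def
      by (auto intro!: continuous_intros add_less_le_mono)
  next
    fix s :: real
    assume s: "0 \<le> s"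
    have \<beta>_s: "classL (\<beta> s)"
      using \<beta> s by (simp add: classKL_def)
    have "continuous_on {0..} (\<lambda>t. \<kappa> (\<mu> s * \<phi> t))"
      using \<phi> by (intro continuous_on_compose2[OF cont_\<kappa>])
        (auto simp: classL_def intro!: continuous_intros prod_nonneg s)
    moreover have "\<kappa> (\<mu> s * \<phi> t) \<le> \<kappa> (\<mu> s * \<phi> r)" if "0 \<le> r" "r \<le> t" for r t
      using that s \<phi> prod_nonneg classK_nonneg[OF \<mu>]
      by (intro classK_mono[OF \<kappa>] mult_left_mono) (auto simp: classL_def)
    moreover have "((\<lambda>t. \<kappa> (\<mu> s * \<phi> t)) \<longlongrightarrow> \<kappa> (\<mu> s * 0)) at_top"
      using \<phi> prod_nonneg[OF s] unfolding classL_def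
      by (intro continuous_on_tendsto_compose[OF cont_\<kappa>] tendsto_mult tendsto_const)
        (auto simp: eventually_at_top_linorder)
    ultimately show "classL (\<lambda>t. \<beta> s t + \<kappa> (\<mu> s * \<phi> t))"
      using \<beta>_s \<kappa> prod_nonneg[OF s] classK_nonneg[OF \<kappa>] unfolding classL_def classK_def
      by (auto intro!: continuous_intros add_mono tendsto_add_zero)
  qed
qed

lemma seg_norm_nonneg: "0 \<le> seg_norm w k"
  unfolding seg_norm_def by (rule Max_ge) auto

lemma norm_le_seg_norm: "i < k \<Longrightarrow> norm (w i) \<le> seg_norm w k"
  unfolding seg_norm_def by (rule Max_ge) auto

lemma seg_norm_le: "0 \<le> c \<Longrightarrow> (\<And>i. i < k \<Longrightarrow> norm (w i) \<le> c) \<Longrightarrow> seg_norm w k \<le> c"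
  unfolding seg_norm_def by (rule Max.boundedI) auto

lemma seg_norm_cong: "(\<And>i. i < k \<Longrightarrow> w i = w' i) \<Longrightarrow> seg_norm w k = seg_norm w' k"
  unfolding seg_norm_def by (metis (no_types, lifting) image_cong lessThan_iff)

lemma seg_norm_diff_le: "seg_norm (\<lambda>i. w i - w' i) k \<le> seg_norm w k + seg_norm w' k"
proof (rule seg_norm_le)
  fix i
  assume "i < k"
  then show "norm (w i - w' i) \<le> seg_norm w k + seg_norm w' k"
    using norm_triangle_ineq4[of "w i" "w' i"] norm_le_seg_norm[of i k w] norm_le_seg_norm[of i k w']
    by linarith
qed (simp add: add_nonneg_nonneg seg_norm_nonneg)

lemma resid_true_state:
  assumes "\<forall>i. y i = h (traj f x0 w i) + v i"
  shows "resid f h y t x0 w = (\<lambda>i. if i \<le> t then v i else 0)"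
  using assms by (simp add: resid_def fun_eq_iff)

lemma FIE_optimal_cost_le:
  assumes opt: "FIE_optimal f h Bw Bv V y xbar t xh wh"
    and meas: "\<forall>i. y i = h (traj f x0 w i) + v i"
    and w_in: "w \<in> Bw" and v_in: "v \<in> Bv"
    and Bv_trunc: "\<forall>\<nu>\<in>Bv. \<forall>t. (\<lambda>i. if i \<le> t then \<nu> i else 0) \<in> Bv"
    and V_lower: "\<And>d \<omega> \<nu>. \<omega> \<in> Bw \<Longrightarrow> \<nu> \<in> Bv \<Longrightarrow>
      \<rho>l (norm d) (real t) + \<gamma>lw (seg_norm \<omega> t) + \<gamma>lv (seg_norm \<nu> (Suc t)) \<le> V t d \<omega> \<nu>"
    and V_upper: "\<And>d \<omega> \<nu>. \<omega> \<in> Bw \<Longrightarrow> \<nu> \<in> Bv \<Longrightarrow>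
      V t d \<omega> \<nu> \<le> \<rho> (norm d) (real t) + \<gamma>w (seg_norm \<omega> t) + \<gamma>v (seg_norm \<nu> (Suc t))"
  shows "\<rho>l (norm (xh - xbar)) (real t) + \<gamma>lw (seg_norm wh t)
           + \<gamma>lv (seg_norm (resid f h y t xh wh) (Suc t))
         \<le> \<rho> (norm (x0 - xbar)) (real t) + \<gamma>w (seg_norm w t) + \<gamma>v (seg_norm v (Suc t))"
proof -
  let ?\<nu> = "resid f h y t x0 w"
  have \<nu>_eq: "?\<nu> = (\<lambda>i. if i \<le> t then v i else 0)"
    using meas by (rule resid_true_state)
  have \<nu>_in: "?\<nu> \<in> Bv"
    using Bv_trunc v_in by (simp add: \<nu>_eq)
  have opt_feas: "wh \<in> Bw" "resid f h y t xh wh \<in> Bv"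
    using opt by (simp_all add: FIE_optimal_def FIE_feasible_def)
  have "seg_norm ?\<nu> (Suc t) = seg_norm v (Suc t)"
    by (rule seg_norm_cong) (simp add: \<nu>_eq)
  then have "V t (x0 - xbar) w ?\<nu>
      \<le> \<rho> (norm (x0 - xbar)) (real t) + \<gamma>w (seg_norm w t) + \<gamma>v (seg_norm v (Suc t))"
    using V_upper[OF w_in \<nu>_in] by simp
  moreover have "V t (xh - xbar) wh (resid f h y t xh wh) \<le> V t (x0 - xbar) w ?\<nu>"
    using opt w_in \<nu>_in by (simp add: FIE_optimal_def FIE_feasible_def)
  ultimately show ?thesis
    using V_lower[OF opt_feas, of "xh - xbar"] by linarith
qed

lemma iIOSS_estimate_error:
  assumes ioss: "iIOSS f h \<beta> \<alpha>1 \<alpha>2"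
    and meas: "\<forall>i. y i = h (traj f x0 w i) + v i"
  shows "norm (traj f x0 w t - traj f xh wh t)
    \<le> \<beta> (norm (x0 - xh)) (real t) + \<alpha>1 (seg_norm w t + seg_norm wh t)
      + \<alpha>2 (seg_norm v (Suc t) + seg_norm (resid f h y t xh wh) (Suc t))"
proof -
  have \<alpha>1: "classK \<alpha>1" and \<alpha>2: "classK \<alpha>2"
    using ioss by (simp_all add: iIOSS_def)
  have "seg_norm (\<lambda>i. h (traj f x0 w i) - h (traj f xh wh i)) (Suc t)
      = seg_norm (\<lambda>i. resid f h y t xh wh i - v i) (Suc t)"
    using meas by (intro seg_norm_cong) (simp add: resid_def)
  also have "\<dots> \<le> seg_norm v (Suc t) + seg_norm (resid f h y t xh wh) (Suc t)"
    using seg_norm_diff_le by (metis add.commute)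
  finally have "\<alpha>2 (seg_norm (\<lambda>i. h (traj f x0 w i) - h (traj f xh wh i)) (Suc t))
      \<le> \<alpha>2 (seg_norm v (Suc t) + seg_norm (resid f h y t xh wh) (Suc t))"
    by (intro classK_mono[OF \<alpha>2] seg_norm_nonneg)
  moreover have "\<alpha>1 (seg_norm (\<lambda>i. w i - wh i) t) \<le> \<alpha>1 (seg_norm w t + seg_norm wh t)"
    by (intro classK_mono[OF \<alpha>1] seg_norm_nonneg seg_norm_diff_le)
  moreover have "norm (traj f x0 w t - traj f xh wh t)
      \<le> \<beta> (norm (x0 - xh)) (real t) + \<alpha>1 (seg_norm (\<lambda>i. w i - wh i) t)
        + \<alpha>2 (seg_norm (\<lambda>i. h (traj f x0 w i) - h (traj f xh wh i)) (Suc t))"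
    using ioss unfolding iIOSS_def by blast
  ultimately show ?thesis
    by linarith
qed

lemma iIOSS_product_error_le:
  assumes ioss: "iIOSS f h \<beta> \<alpha>1 \<alpha>2"
    and meas: "\<forall>i. y i = h (traj f x0 w i) + v i"
    and \<beta>_prod: "\<forall>s\<ge>0. \<forall>t\<ge>0. \<beta> s t = \<mu>1 s * \<phi>1 t"
    and \<mu>1: "classK \<mu>1" and \<phi>1: "classL \<phi>1"
  shows "norm (traj f x0 w t - traj f xh wh t)
    \<le> \<mu>1 (2 * norm (x0 - xbar)) * \<phi>1 (real t) + \<mu>1 (2 * norm (xh - xbar)) * \<phi>1 (real t)
      + \<alpha>1 (2 * seg_norm w t) + \<alpha>1 (2 * seg_norm wh t)
      + \<alpha>2 (2 * seg_norm v (Suc t)) + \<alpha>2 (2 * seg_norm (resid f h y t xh wh) (Suc t))"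
proof -
  have \<alpha>1: "classK \<alpha>1" and \<alpha>2: "classK \<alpha>2"
    using ioss by (simp_all add: iIOSS_def)
  have "norm (x0 - xh) \<le> norm (x0 - xbar) + norm (xh - xbar)"
    using norm_triangle_ineq4[of "x0 - xbar" "xh - xbar"] by simp
  then have "\<mu>1 (norm (x0 - xh)) \<le> \<mu>1 (2 * norm (x0 - xbar)) + \<mu>1 (2 * norm (xh - xbar))"
    using classK_mono[OF \<mu>1, of "norm (x0 - xh)"] classK_add_le[OF \<mu>1, of "norm (x0 - xbar)" "norm (xh - xbar)"]
    by (meson norm_ge_zero order_trans)
  then have "\<beta> (norm (x0 - xh)) (real t)
      \<le> \<mu>1 (2 * norm (x0 - xbar)) * \<phi>1 (real t) + \<mu>1 (2 * norm (xh - xbar)) * \<phi>1 (real t)"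
    using \<beta>_prod classL_nonneg[OF \<phi>1, of "real t"] by (simp add: mult_right_mono flip: distrib_right)
  moreover have "\<alpha>1 (seg_norm w t + seg_norm wh t) \<le> \<alpha>1 (2 * seg_norm w t) + \<alpha>1 (2 * seg_norm wh t)"
    by (intro classK_add_le[OF \<alpha>1] seg_norm_nonneg)
  moreover have "\<alpha>2 (seg_norm v (Suc t) + seg_norm (resid f h y t xh wh) (Suc t))
      \<le> \<alpha>2 (2 * seg_norm v (Suc t)) + \<alpha>2 (2 * seg_norm (resid f h y t xh wh) (Suc t))"
    by (intro classK_add_le[OF \<alpha>2] seg_norm_nonneg)
  ultimately show ?thesis
    using iIOSS_estimate_error[OF ioss meas, of t xh wh] by linarith
qed

lemma estimate_terms_le_cost:
  assumes \<mu>: "classK \<mu>1" "classK \<mu>2" and \<phi>: "classL \<phi>1" "classL \<phi>2"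
    and \<alpha>: "classK \<alpha>1" "classK \<alpha>2" and \<gamma>l: "classKinf \<gamma>lw" "classKinf \<gamma>lv"
    and compat: "\<forall>\<pi>. classK \<pi> \<longrightarrow> (\<exists>\<pi>'. classK \<pi>' \<and>
        (\<forall>s t r. 0 \<le> s \<longrightarrow> 0 \<le> t \<longrightarrow> 0 \<le> r \<longrightarrow> \<mu>2 r * \<phi>2 t \<le> \<pi> s \<longrightarrow>
           \<mu>1 (4 * r) * \<phi>1 t \<le> \<pi>' s))"
  obtains K where "classK K"
    and "\<And>r a b t U. 0 \<le> r \<Longrightarrow> 0 \<le> a \<Longrightarrow> 0 \<le> b \<Longrightarrow> 0 \<le> t \<Longrightarrow>
      \<mu>2 r * \<phi>2 t + \<gamma>lw a + \<gamma>lv b \<le> U \<Longrightarrow> \<mu>1 (2 * r) * \<phi>1 t + \<alpha>1 (2 * a) + \<alpha>2 (2 * b) \<le> K U"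
proof -
  obtain \<pi>' where \<pi>': "classK \<pi>'" and \<pi>'_bound: "\<And>s t r. 0 \<le> s \<Longrightarrow> 0 \<le> t \<Longrightarrow> 0 \<le> r \<Longrightarrow>
      \<mu>2 r * \<phi>2 t \<le> s \<Longrightarrow> \<mu>1 (4 * r) * \<phi>1 t \<le> \<pi>' s"
    using compat classK_ident by blast
  obtain \<kappa>1 where \<kappa>1: "classK \<kappa>1" and \<alpha>1_eq: "\<And>a. 0 \<le> a \<Longrightarrow> \<alpha>1 (2 * a) = \<kappa>1 (\<gamma>lw a)"
    using classK_factor_classKinf[OF \<gamma>l(1) classK_scale[OF \<alpha>(1) zero_less_numeral]] by auto
  obtain \<kappa>2 where \<kappa>2: "classK \<kappa>2" and \<alpha>2_eq: "\<And>b. 0 \<le> b \<Longrightarrow> \<alpha>2 (2 * b) = \<kappa>2 (\<gamma>lv b)"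
    using classK_factor_classKinf[OF \<gamma>l(2) classK_scale[OF \<alpha>(2) zero_less_numeral]] by auto
  have "\<mu>1 (2 * r) * \<phi>1 t + \<alpha>1 (2 * a) + \<alpha>2 (2 * b) \<le> \<pi>' U + \<kappa>1 U + \<kappa>2 U"
    if nonneg: "0 \<le> r" "0 \<le> a" "0 \<le> b" "0 \<le> t"
      and cost: "\<mu>2 r * \<phi>2 t + \<gamma>lw a + \<gamma>lv b \<le> U" for r a b t U
  proof -
    have terms_nonneg: "0 \<le> \<mu>2 r * \<phi>2 t" "0 \<le> \<gamma>lw a" "0 \<le> \<gamma>lv b"
      using nonneg classK_nonneg[OF \<mu>(2), of r] classL_nonneg[OF \<phi>(2), of t]
        classK_nonneg[OF classKinf_imp_classK[OF \<gamma>l(1)], of a]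
        classK_nonneg[OF classKinf_imp_classK[OF \<gamma>l(2)], of b]
      by simp_all
    then have le_U: "\<mu>2 r * \<phi>2 t \<le> U" "\<gamma>lw a \<le> U" "\<gamma>lv b \<le> U" "0 \<le> U"
      using cost by linarith+
    have "\<mu>1 (2 * r) * \<phi>1 t \<le> \<mu>1 (4 * r) * \<phi>1 t"
      using classK_mono[OF \<mu>(1), of "2 * r" "4 * r"] classL_nonneg[OF \<phi>(1) nonneg(4)] nonneg(1)
      by (simp add: mult_right_mono)
    also have "\<dots> \<le> \<pi>' U"
      by (rule \<pi>'_bound[OF le_U(4) nonneg(4) nonneg(1) le_U(1)])
    finally show ?thesis
      using \<alpha>1_eq[OF nonneg(2)] classK_mono[OF \<kappa>1 terms_nonneg(2) le_U(2)]
        \<alpha>2_eq[OF nonneg(3)] classK_mono[OF \<kappa>2 terms_nonneg(3) le_U(3)]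
      by linarith
  qed
  moreover have "classK (\<lambda>u. \<pi>' u + \<kappa>1 u + \<kappa>2 u)"
    by (intro classK_add \<pi>' \<kappa>1 \<kappa>2)
  ultimately show ?thesis
    using that by blast
qed

lemma gains_of_cost_bound:
  assumes \<mu>: "classK \<mu>1" "classK \<mu>2" "classK \<mu>3" and \<phi>: "classL \<phi>1" "classL \<phi>2"
    and \<alpha>: "classK \<alpha>1" "classK \<alpha>2"
    and \<gamma>l: "classKinf \<gamma>lw" "classKinf \<gamma>lv" and \<gamma>: "classK \<gamma>w" "classK \<gamma>v"
    and compat: "\<forall>\<pi>. classK \<pi> \<longrightarrow> (\<exists>\<pi>'. classK \<pi>' \<and>
        (\<forall>s t r. 0 \<le> s \<longrightarrow> 0 \<le> t \<longrightarrow> 0 \<le> r \<longrightarrow> \<mu>2 r * \<phi>2 t \<le> \<pi> s \<longrightarrow>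
           \<mu>1 (4 * r) * \<phi>1 t \<le> \<pi>' s))"
  obtains \<beta>x \<alpha>w \<alpha>v where "classKL \<beta>x" and "classK \<alpha>w" and "classK \<alpha>v"
    and "\<And>d r a b W N t. 0 \<le> d \<Longrightarrow> 0 \<le> r \<Longrightarrow> 0 \<le> a \<Longrightarrow> 0 \<le> b \<Longrightarrow> 0 \<le> W \<Longrightarrow> 0 \<le> N \<Longrightarrow> 0 \<le> t \<Longrightarrow>
      \<mu>2 r * \<phi>2 t + \<gamma>lw a + \<gamma>lv b \<le> \<mu>3 d * \<phi>2 t + \<gamma>w W + \<gamma>v N \<Longrightarrow>
      \<mu>1 (2 * d) * \<phi>1 t + \<mu>1 (2 * r) * \<phi>1 t + \<alpha>1 (2 * W) + \<alpha>1 (2 * a) + \<alpha>2 (2 * N) + \<alpha>2 (2 * b)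
        \<le> \<beta>x d t + \<alpha>w W + \<alpha>v N"
proof -
  obtain K where K: "classK K" and K_bound: "\<And>r a b t U. 0 \<le> r \<Longrightarrow> 0 \<le> a \<Longrightarrow> 0 \<le> b \<Longrightarrow> 0 \<le> t \<Longrightarrow>
      \<mu>2 r * \<phi>2 t + \<gamma>lw a + \<gamma>lv b \<le> U \<Longrightarrow> \<mu>1 (2 * r) * \<phi>1 t + \<alpha>1 (2 * a) + \<alpha>2 (2 * b) \<le> K U"
    using estimate_terms_le_cost[OF \<mu>(1,2) \<phi> \<alpha> \<gamma>l compat] by blast
  have K3: "classK (\<lambda>u. K (3 * u))"
    using classK_scale[OF K zero_less_numeral] .
  have "classKL (\<lambda>s t. s / (1 + t) + \<mu>1 (2 * s) * \<phi>1 t)"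
    using classKL_add_comp_mult[OF classKL_div_one_plus classK_ident
        classK_scale[OF \<mu>(1) zero_less_numeral] \<phi>(1)] .
  then have "classKL (\<lambda>s t. s / (1 + t) + \<mu>1 (2 * s) * \<phi>1 t + K (3 * (\<mu>3 s * \<phi>2 t)))"
    using classKL_add_comp_mult[OF _ K3 \<mu>(3) \<phi>(2)] by blast
  moreover have "classK (\<lambda>s. \<alpha>1 (2 * s) + K (3 * \<gamma>w s))" "classK (\<lambda>s. \<alpha>2 (2 * s) + K (3 * \<gamma>v s))"
    using classK_add[OF classK_scale[OF \<alpha>(1) zero_less_numeral] classK_comp[OF K3 \<gamma>(1)]]
      classK_add[OF classK_scale[OF \<alpha>(2) zero_less_numeral] classK_comp[OF K3 \<gamma>(2)]] .
  moreover
  have "\<mu>1 (2 * d) * \<phi>1 t + \<mu>1 (2 * r) * \<phi>1 t + \<alpha>1 (2 * W) + \<alpha>1 (2 * a) + \<alpha>2 (2 * N) + \<alpha>2 (2 * b)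
      \<le> (d / (1 + t) + \<mu>1 (2 * d) * \<phi>1 t + K (3 * (\<mu>3 d * \<phi>2 t)))
        + (\<alpha>1 (2 * W) + K (3 * \<gamma>w W)) + (\<alpha>2 (2 * N) + K (3 * \<gamma>v N))"
    if nonneg: "0 \<le> d" "0 \<le> r" "0 \<le> a" "0 \<le> b" "0 \<le> W" "0 \<le> N" "0 \<le> t"
      and cost: "\<mu>2 r * \<phi>2 t + \<gamma>lw a + \<gamma>lv b \<le> \<mu>3 d * \<phi>2 t + \<gamma>w W + \<gamma>v N"
    for d r a b W N t
  proof -
    have "K (\<mu>3 d * \<phi>2 t + \<gamma>w W + \<gamma>v N) \<le> K (3 * (\<mu>3 d * \<phi>2 t)) + K (3 * \<gamma>w W) + K (3 * \<gamma>v N)"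
      using nonneg classK_nonneg[OF \<mu>(3), of d] classL_nonneg[OF \<phi>(2), of t]
        classK_nonneg[OF \<gamma>(1), of W] classK_nonneg[OF \<gamma>(2), of N]
      by (intro classK_add3_le[OF K]) simp_all
    moreover have "0 \<le> d / (1 + t)"
      using nonneg by simp
    ultimately show ?thesis
      using K_bound[OF nonneg(2-4,7) cost] by linarith
  qed
  ultimately show ?thesis
    by (rule that)
qed

theorem corollary1:
  fixes f :: "'x::euclidean_space \<Rightarrow> 'w::euclidean_space \<Rightarrow> 'x"
    and h :: "'x \<Rightarrow> 'y::euclidean_space"
    and \<beta> :: "real \<Rightarrow> real \<Rightarrow> real" and \<alpha>1 \<alpha>2 :: "real \<Rightarrow> real"
    and V :: "nat \<Rightarrow> 'x \<Rightarrow> (nat \<Rightarrow> 'w) \<Rightarrow> (nat \<Rightarrow> 'y) \<Rightarrow> real"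
    and Bw :: "(nat \<Rightarrow> 'w) set" and Bv :: "(nat \<Rightarrow> 'y) set"
    and \<rho>l \<rho> :: "real \<Rightarrow> real \<Rightarrow> real" and \<gamma>lw \<gamma>lv \<gamma>w \<gamma>v :: "real \<Rightarrow> real"
    and \<mu>1 \<mu>2 \<mu>3 \<phi>1 \<phi>2 :: "real \<Rightarrow> real"
    and x0 xbar :: 'x and w :: "nat \<Rightarrow> 'w" and v y :: "nat \<Rightarrow> 'y"
    and xhat :: "nat \<Rightarrow> 'x" and what :: "nat \<Rightarrow> nat \<Rightarrow> 'w"
  assumes f_cont: "continuous_on UNIV (\<lambda>p. f (fst p) (snd p))"
    and h_cont: "continuous_on UNIV h"
    and Bw_bounded: "\<forall>\<omega>\<in>Bw. bounded (range \<omega>)"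
    and Bv_bounded: "\<forall>\<nu>\<in>Bv. bounded (range \<nu>)"
    and Bv_trunc: "\<forall>\<nu>\<in>Bv. \<forall>t. (\<lambda>i. if i \<le> t then \<nu> i else 0) \<in> Bv"
    and w_in: "w \<in> Bw" and v_in: "v \<in> Bv"
    and meas: "\<forall>i. y i = h (traj f x0 w i) + v i"
    \<comment> \<open>(a) i-IOSS\<close>
    and ioss: "iIOSS f h \<beta> \<alpha>1 \<alpha>2"
    \<comment> \<open>(b) the infimum is attained: (xhat t, what t) is an optimal solution at every t\<close>
    and opt: "\<forall>t. FIE_optimal f h Bw Bv V y xbar t (xhat t) (what t)"
    and V_cont: "\<forall>t. continuous_on UNIV (\<lambda>p. V t (fst p) (fst (snd p)) (snd (snd p)))"
    and \<rho>l_KL: "classKL \<rho>l" and \<rho>_KL: "classKL \<rho>"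
    and \<gamma>_Kinf: "classKinf \<gamma>lw" "classKinf \<gamma>lv" "classKinf \<gamma>w" "classKinf \<gamma>v"
    and V_bounds: "\<forall>t d \<omega> \<nu>. \<omega> \<in> Bw \<longrightarrow> \<nu> \<in> Bv \<longrightarrow>
        \<rho>l (norm d) (real t) + \<gamma>lw (seg_norm \<omega> t) + \<gamma>lv (seg_norm \<nu> (Suc t)) \<le> V t d \<omega> \<nu>
      \<and> V t d \<omega> \<nu> \<le> \<rho> (norm d) (real t) + \<gamma>w (seg_norm \<omega> t) + \<gamma>v (seg_norm \<nu> (Suc t))"
    \<comment> \<open>(c) product structure and the compatibility condition\<close>
    and \<mu>_K: "classK \<mu>1" "classK \<mu>2" "classK \<mu>3"
    and \<phi>_L: "classL \<phi>1" "classL \<phi>2"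
    and \<beta>_prod: "\<forall>s\<ge>0. \<forall>t\<ge>0. \<beta> s t = \<mu>1 s * \<phi>1 t"
    and \<rho>l_prod: "\<forall>s\<ge>0. \<forall>t\<ge>0. \<rho>l s t = \<mu>2 s * \<phi>2 t"
    and \<rho>_prod: "\<forall>s\<ge>0. \<forall>t\<ge>0. \<rho> s t = \<mu>3 s * \<phi>2 t"
    and compat: "\<forall>\<pi>. classK \<pi> \<longrightarrow> (\<exists>\<pi>'. classK \<pi>' \<and>
        (\<forall>s t r. 0 \<le> s \<longrightarrow> 0 \<le> t \<longrightarrow> 0 \<le> r \<longrightarrow> \<mu>2 r * \<phi>2 t \<le> \<pi> s \<longrightarrow>
           \<mu>1 (4 * r) * \<phi>1 t \<le> \<pi>' s))"
  shows "\<exists>\<beta>x \<alpha>w \<alpha>v. classKL \<beta>x \<and> classK \<alpha>w \<and> classK \<alpha>v \<and>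
    (\<forall>t. norm (traj f x0 w t - traj f (xhat t) (what t) t)
       \<le> \<beta>x (norm (x0 - xbar)) (real t) + \<alpha>w (seg_norm w t) + \<alpha>v (seg_norm v (Suc t)))"
proof -
  have \<gamma>_K: "classK \<gamma>w" "classK \<gamma>v"
    using \<gamma>_Kinf(3,4) by (simp_all add: classKinf_imp_classK)
  have \<alpha>_K: "classK \<alpha>1" "classK \<alpha>2"
    using ioss by (simp_all add: iIOSS_def)
  obtain \<beta>x \<alpha>w \<alpha>v where gains: "classKL \<beta>x" "classK \<alpha>w" "classK \<alpha>v"
    and dominate: "\<And>d r a b W N t. 0 \<le> d \<Longrightarrow> 0 \<le> r \<Longrightarrow> 0 \<le> a \<Longrightarrow> 0 \<le> b \<Longrightarrow> 0 \<le> W \<Longrightarrow> 0 \<le> N \<Longrightarrow> 0 \<le> t \<Longrightarrow>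
      \<mu>2 r * \<phi>2 t + \<gamma>lw a + \<gamma>lv b \<le> \<mu>3 d * \<phi>2 t + \<gamma>w W + \<gamma>v N \<Longrightarrow>
      \<mu>1 (2 * d) * \<phi>1 t + \<mu>1 (2 * r) * \<phi>1 t + \<alpha>1 (2 * W) + \<alpha>1 (2 * a) + \<alpha>2 (2 * N) + \<alpha>2 (2 * b)
        \<le> \<beta>x d t + \<alpha>w W + \<alpha>v N"
    using gains_of_cost_bound[OF \<mu>_K \<phi>_L \<alpha>_K \<gamma>_Kinf(1,2) \<gamma>_K compat] by blast
  have "norm (traj f x0 w t - traj f (xhat t) (what t) t)
      \<le> \<beta>x (norm (x0 - xbar)) (real t) + \<alpha>w (seg_norm w t) + \<alpha>v (seg_norm v (Suc t))" for t
  proof -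
    have "\<rho>l (norm (xhat t - xbar)) (real t) + \<gamma>lw (seg_norm (what t) t)
        + \<gamma>lv (seg_norm (resid f h y t (xhat t) (what t)) (Suc t))
      \<le> \<rho> (norm (x0 - xbar)) (real t) + \<gamma>w (seg_norm w t) + \<gamma>v (seg_norm v (Suc t))"
      using V_bounds by (intro FIE_optimal_cost_le[OF opt[rule_format] meas w_in v_in Bv_trunc]) blast+
    then have "\<mu>2 (norm (xhat t - xbar)) * \<phi>2 (real t) + \<gamma>lw (seg_norm (what t) t)
        + \<gamma>lv (seg_norm (resid f h y t (xhat t) (what t)) (Suc t))
      \<le> \<mu>3 (norm (x0 - xbar)) * \<phi>2 (real t) + \<gamma>w (seg_norm w t) + \<gamma>v (seg_norm v (Suc t))"
      using \<rho>l_prod \<rho>_prod by simp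
    from dominate[OF norm_ge_zero norm_ge_zero seg_norm_nonneg seg_norm_nonneg seg_norm_nonneg
        seg_norm_nonneg of_nat_0_le_iff this]
    show ?thesis
      using iIOSS_product_error_le[OF ioss meas \<beta>_prod \<mu>_K(1) \<phi>_L(1), of t "xhat t" "what t" xbar]
      by linarith
  qed
  with gains show ?thesis
    by blast
qed

end
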